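(* Let $p:\mathbb E\to\mathbb B$ be a posetal fibration with fibred small limits and $\mathcal T$ a monad on $\mathbb B$. For any class $V$ and any cone $r=\{r_X:V\to\mathbf{Cls}(\mathcal T,X)\}_{X\in\mathbb E}$ from $V$ over $\mathbf{Cls}(\mathcal T,-):\mathbf{Split}(\mathbb E)^{op}\to\mathbf{Set}$ satisfying the $\phi$-inequality, there exists a unique function $m:V\to\mathbf{Lift}(\mathcal T)$ such that $r_X=q_X\circ m$ for all $X\in\mathbb E$.
   Context: $p$ posetal: fibres are posets; $p$ faithful, $\mathbb E(X,Y)\subseteq\mathbb B(pX,pY)$; fibres have arbitrary meets. $\mathcal T=(T,\eta,\mu)$, $f^\#=\mu\circ Tf$. $\mathbf{Lift}(\mathcal T)$: class of liftings of $\mathcal T$ along $p$ (monads on $\mathbb E$ with $p\dot T=Tp$, $p\dot\eta=\eta p$, $p\dot\mu=\mu p$), ordered pointwise and with pointwise meets. For $R\in\mathbb B$, $S\in\mathbb E_{TR}$, $[S]^R\in\mathbf{Lift}(\mathcal T)$ is the (pointwise) codensity lifting with single parameter $(R,S)$, with $[S]^RY=\bigwedge_{f\in\mathbb E(Y,S)}(f^\#)^{-1}(S)$. $\mathbf{Cls}(\mathcal T,X)=\{S\in\mathbb E_{T(pX)}\mid S=[S]^{pX}X\}$, ordered as in the fibre; $q_X(\dot T)=\dot TX$; $\phi_{X,Y}:\mathbf{Cls}(\mathcal T,X)\to\mathbf{Cls}(\mathcal T,Y)$, $\phi_{X,Y}(S)=[S]^{pX}Y$. $X\lhd Y$ means there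 is a split monomorphism $X\to Y$ in $\mathbb E$; $\mathbf{Split}(\mathbb E)$ is the preordered class $(\mathrm{Obj}\,\mathbb E,\lhd)$, and $\mathbf{Cls}(\mathcal T,-)$ is the functor $\mathbf{Split}(\mathbb E)^{op}\to\mathbf{Set}$ sending $X\lhd Y$ to $\phi_{Y,X}$. A cone from a class $V$ over it is a family $r_X:V\to\mathbf{Cls}(\mathcal T,X)$ with $\phi_{Y,X}\circ r_Y=r_X$ whenever $X\lhd Y$; it satisfies the $\phi$-inequality if $\phi_{Y,X}(r_Y(v))\ge r_X(v)$ for all $X,Y\in\mathbb E$ and $v\in V$. *)

theory Defs
  imports "HOL-Algebra.Lattice" "HOL-Library.FuncSet"
begin

section \<open>Categories, functors, monads\<close>

record ('o, 'a) cat =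
  Obj :: "'o set"
  Arr :: "'a set"
  Dom :: "'a \<Rightarrow> 'o"
  Cod :: "'a \<Rightarrow> 'o"
  Ident :: "'o \<Rightarrow> 'a"
  Comp :: "'a \<Rightarrow> 'a \<Rightarrow> 'a"  (infixr \<open>\<cdot>\<index>\<close> 75)

definition Hom :: "('o, 'a) cat \<Rightarrow> 'o \<Rightarrow> 'o \<Rightarrow> 'a set" where
  "Hom C X Y = {f \<in> Arr C. Dom C f = X \<and> Cod C f = Y}"

locale cat =
  fixes C :: "('o, 'a) cat"
  assumes dom_obj: "f \<in> Arr C \<Longrightarrow> Dom C f \<in> Obj C"
    and cod_obj: "f \<in> Arr C \<Longrightarrow> Cod C f \<in> Obj C"
    and ident_hom: "X \<in> Obj C \<Longrightarrow> Ident C X \<in> Hom C X X"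
    and comp_hom: "f \<in> Hom C X Y \<Longrightarrow> g \<in> Hom C Y Z \<Longrightarrow> g \<cdot>\<^bsub>C\<^esub> f \<in> Hom C X Z"
    and comp_ident: "f \<in> Hom C X Y \<Longrightarrow> f \<cdot>\<^bsub>C\<^esub> Ident C X = f"
    and ident_comp: "f \<in> Hom C X Y \<Longrightarrow> Ident C Y \<cdot>\<^bsub>C\<^esub> f = f"
    and comp_assoc: "f \<in> Hom C W X \<Longrightarrow> g \<in> Hom C X Y \<Longrightarrow> h \<in> Hom C Y Z \<Longrightarrow>
      (h \<cdot>\<^bsub>C\<^esub> g) \<cdot>\<^bsub>C\<^esub> f = h \<cdot>\<^bsub>C\<^esub> (g \<cdot>\<^bsub>C\<^esub> f)"

record ('o, 'a, 'p, 'b) fctr =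
  FObj :: "'o \<Rightarrow> 'p"
  FArr :: "'a \<Rightarrow> 'b"

locale cat_functor = dom: cat C + cod: cat D
  for C :: "('o, 'a) cat" and D :: "('p, 'b) cat" +
  fixes F :: "('o, 'a, 'p, 'b, 'z) fctr_scheme"
  assumes fobj: "X \<in> Obj C \<Longrightarrow> FObj F X \<in> Obj D"
    and farr: "f \<in> Hom C X Y \<Longrightarrow> FArr F f \<in> Hom D (FObj F X) (FObj F Y)"
    and farr_ident: "X \<in> Obj C \<Longrightarrow> FArr F (Ident C X) = Ident D (FObj F X)"
    and farr_comp: "f \<in> Hom C X Y \<Longrightarrow> g \<in> Hom C Y Z \<Longrightarrow>
      FArr F (g \<cdot>\<^bsub>C\<^esub> f) = FArr F g \<cdot>\<^bsub>D\<^esub> FArr F f"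

record ('o, 'a) mnd = "('o, 'a, 'o, 'a) fctr" +
  Unit :: "'o \<Rightarrow> 'a"
  Mult :: "'o \<Rightarrow> 'a"

locale cat_monad = cat_functor C C T
  for C :: "('o, 'a) cat" and T :: "('o, 'a) mnd" +
  assumes unit_hom: "X \<in> Obj C \<Longrightarrow> Unit T X \<in> Hom C X (FObj T X)"
    and mult_hom: "X \<in> Obj C \<Longrightarrow> Mult T X \<in> Hom C (FObj T (FObj T X)) (FObj T X)"
    and unit_natural: "f \<in> Hom C X Y \<Longrightarrow>
      FArr T f \<cdot>\<^bsub>C\<^esub> Unit T X = Unit T Y \<cdot>\<^bsub>C\<^esub> f"
    and mult_natural: "f \<in> Hom C X Y \<Longrightarrow>
      FArr T f \<cdot>\<^bsub>C\<^esub> Mult T X = Mult T Y \<cdot>\<^bsub>C\<^esub> FArr T (FArr T f)"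
    and mult_unit: "X \<in> Obj C \<Longrightarrow> Mult T X \<cdot>\<^bsub>C\<^esub> Unit T (FObj T X) = Ident C (FObj T X)"
    and mult_map_unit: "X \<in> Obj C \<Longrightarrow>
      Mult T X \<cdot>\<^bsub>C\<^esub> FArr T (Unit T X) = Ident C (FObj T X)"
    and mult_mult: "X \<in> Obj C \<Longrightarrow>
      Mult T X \<cdot>\<^bsub>C\<^esub> Mult T (FObj T X) = Mult T X \<cdot>\<^bsub>C\<^esub> FArr T (Mult T X)"

text \<open>The Kleisli extension \<open>f\<^sup>#\<close> of \<open>f : I \<rightarrow> T R\<close>; the object \<open>R\<close> has to be passed
  explicitly because the codomain of \<open>f\<close> does not determine it.\<close>

definition kleisli_ext :: "('o, 'a) cat \<Rightarrow> ('o, 'a) mnd \<Rightarrow> 'o \<Rightarrow> 'a \<Rightarrow> 'a" where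
  "kleisli_ext C T R f = Mult T R \<cdot>\<^bsub>C\<^esub> FArr T f"

definition split_le :: "('o, 'a) cat \<Rightarrow> 'o \<Rightarrow> 'o \<Rightarrow> bool" where
  "split_le C X Y \<longleftrightarrow> (\<exists>s \<in> Hom C X Y. \<exists>e \<in> Hom C Y X. e \<cdot>\<^bsub>C\<^esub> s = Ident C X)"


section \<open>Posetal fibrations\<close>

type_synonym ('e, 'f, 'b, 'c) proj = "('e, 'f, 'b, 'c) fctr"

definition fibre_obj :: "('e, 'f) cat \<Rightarrow> ('e, 'f, 'b, 'c) proj \<Rightarrow> 'b \<Rightarrow> 'e set" where
  "fibre_obj E p I = {X \<in> Obj E. FObj p X = I}"

definition vertical ::
  "('e, 'f) cat \<Rightarrow> ('b, 'c) cat \<Rightarrow> ('e, 'f, 'b, 'c) proj \<Rightarrow> 'e \<Rightarrow> 'e \<Rightarrow> 'f set" where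
  "vertical E B p X Y = {f \<in> Hom E X Y. FArr p f = Ident B (FObj p X)}"

text \<open>The order of the fibre over \<open>I\<close>, where \<open>X \<le> Y\<close> means that the fibre category has an arrow
  \<open>X \<rightarrow> Y\<close>.\<close>

definition fibre ::
  "('e, 'f) cat \<Rightarrow> ('b, 'c) cat \<Rightarrow> ('e, 'f, 'b, 'c) proj \<Rightarrow> 'b \<Rightarrow> 'e gorder" where
  "fibre E B p I =
    \<lparr> carrier = fibre_obj E p I, eq = (=), le = (\<lambda>X Y. vertical E B p X Y \<noteq> {}) \<rparr>"

definition cartesian ::
  "('e, 'f) cat \<Rightarrow> ('b, 'c) cat \<Rightarrow> ('e, 'f, 'b, 'c) proj \<Rightarrow> 'f \<Rightarrow> bool" where
  "cartesian E B p f \<longleftrightarrow> f \<in> Arr E \<and>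
    (\<forall>Z \<in> Obj E. \<forall>g \<in> Hom E Z (Cod E f). \<forall>h \<in> Hom B (FObj p Z) (FObj p (Dom E f)).
      FArr p g = FArr p f \<cdot>\<^bsub>B\<^esub> h \<longrightarrow>
      (\<exists>!k. k \<in> Hom E Z (Dom E f) \<and> FArr p k = h \<and> f \<cdot>\<^bsub>E\<^esub> k = g))"

locale fibration = cat_functor E B p
  for E :: "('e, 'f) cat" and B :: "('b, 'c) cat" and p :: "('e, 'f, 'b, 'c) proj" +
  assumes cartesian_lift: "Y \<in> Obj E \<Longrightarrow> u \<in> Hom B I (FObj p Y) \<Longrightarrow>
    \<exists>f \<in> Arr E. Cod E f = Y \<and> FArr p f = u \<and> cartesian E B p f"

locale posetal_fibration = fibration E B p
  for E :: "('e, 'f) cat" and B :: "('b, 'c) cat" and p :: "('e, 'f, 'b, 'c) proj" +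
  assumes vertical_unique:
      "f \<in> vertical E B p X Y \<Longrightarrow> g \<in> vertical E B p X Y \<Longrightarrow> f = g"
    and fibre_order: "I \<in> Obj B \<Longrightarrow> partial_order (fibre E B p I)"

text \<open>The inverse image \<open>u\<^sup>-\<^sup>1(Y)\<close>. In a posetal fibration the domain of a cartesian lifting is
  unique, because vertically isomorphic objects are equal.\<close>

definition inverse_image ::
  "('e, 'f) cat \<Rightarrow> ('b, 'c) cat \<Rightarrow> ('e, 'f, 'b, 'c) proj \<Rightarrow> 'c \<Rightarrow> 'e \<Rightarrow> 'e" where
  "inverse_image E B p u Y =
    (THE X. \<exists>f \<in> Hom E X Y. FArr p f = u \<and> cartesian E B p f)"

text \<open>A limit in a poset is the greatest lower bound of the image of the diagram, so fibred small
  limits amount to meets in the fibres which are preserved by inverse images. All sets of objects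
  of a fibre are admitted, so the fibres have arbitrary meets.\<close>

locale posetal_fibration_with_limits = posetal_fibration E B p
  for E :: "('e, 'f) cat" and B :: "('b, 'c) cat" and p :: "('e, 'f, 'b, 'c) proj" +
  assumes meet_exists: "I \<in> Obj B \<Longrightarrow> A \<subseteq> fibre_obj E p I \<Longrightarrow>
      \<exists>M. greatest (fibre E B p I) M (Lower (fibre E B p I) A)"
    and meet_preserved: "u \<in> Hom B I J \<Longrightarrow> A \<subseteq> fibre_obj E p J \<Longrightarrow>
      greatest (fibre E B p J) M (Lower (fibre E B p J) A) \<Longrightarrow>
      greatest (fibre E B p I) (inverse_image E B p u M)
        (Lower (fibre E B p I) (inverse_image E B p u ` A))"


section \<open>Liftings of a monad\<close>

text \<open>The extensionality conditions pin down the values outside the objects and arrows of \<open>E\<close>, so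
  that equality of elements of \<open>Lift\<close> is equality of monads on \<open>E\<close>.\<close>

definition Lift ::
  "('e, 'f) cat \<Rightarrow> ('b, 'c) cat \<Rightarrow> ('e, 'f, 'b, 'c) proj \<Rightarrow> ('b, 'c) mnd \<Rightarrow> ('e, 'f) mnd set" where
  "Lift E B p T = {L. cat_monad E L \<and>
     FObj L \<in> extensional (Obj E) \<and> FArr L \<in> extensional (Arr E) \<and>
     Unit L \<in> extensional (Obj E) \<and> Mult L \<in> extensional (Obj E) \<and>
     (\<forall>X \<in> Obj E. FObj p (FObj L X) = FObj T (FObj p X)) \<and>
     (\<forall>f \<in> Arr E. FArr p (FArr L f) = FArr T (FArr p f)) \<and>
     (\<forall>X \<in> Obj E. FArr p (Unit L X) = Unit T (FObj p X)) \<and>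
     (\<forall>X \<in> Obj E. FArr p (Mult L X) = Mult T (FObj p X))}"

definition codensity_obj ::
  "('e, 'f) cat \<Rightarrow> ('b, 'c) cat \<Rightarrow> ('e, 'f, 'b, 'c) proj \<Rightarrow> ('b, 'c) mnd \<Rightarrow>
    'b \<Rightarrow> 'e \<Rightarrow> 'e \<Rightarrow> 'e" where
  "codensity_obj E B p T R S Y =
    \<Sqinter>\<^bsub>fibre E B p (FObj T (FObj p Y))\<^esub>
      ((\<lambda>f. inverse_image E B p (kleisli_ext B T R (FArr p f)) S) ` Hom E Y S)"

text \<open>The codensity lifting \<open>[S]\<^sup>R\<close> for \<open>S\<close> over \<open>T R\<close>. Since \<open>p\<close> is faithful, the arrow part, the
  unit and the multiplication are the unique arrows above those of \<open>T\<close>.\<close>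

definition codensity ::
  "('e, 'f) cat \<Rightarrow> ('b, 'c) cat \<Rightarrow> ('e, 'f, 'b, 'c) proj \<Rightarrow> ('b, 'c) mnd \<Rightarrow>
    'b \<Rightarrow> 'e \<Rightarrow> ('e, 'f) mnd" where
  "codensity E B p T R S = (let D = codensity_obj E B p T R S in
    \<lparr> FObj = restrict D (Obj E),
      FArr = (\<lambda>f \<in> Arr E. THE g. g \<in> Hom E (D (Dom E f)) (D (Cod E f)) \<and>
        FArr p g = FArr T (FArr p f)),
      Unit = (\<lambda>X \<in> Obj E. THE g. g \<in> Hom E X (D X) \<and> FArr p g = Unit T (FObj p X)),
      Mult = (\<lambda>X \<in> Obj E. THE g. g \<in> Hom E (D (D X)) (D X) \<and>
        FArr p g = Mult T (FObj p X)) \<rparr>)"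

definition Cls ::
  "('e, 'f) cat \<Rightarrow> ('b, 'c) cat \<Rightarrow> ('e, 'f, 'b, 'c) proj \<Rightarrow> ('b, 'c) mnd \<Rightarrow> 'e \<Rightarrow> 'e set" where
  "Cls E B p T X = {S \<in> fibre_obj E p (FObj T (FObj p X)).
     S = FObj (codensity E B p T (FObj p X) S) X}"

definition q_map :: "'e \<Rightarrow> ('e, 'f) mnd \<Rightarrow> 'e" where
  "q_map X L = FObj L X"

definition phi ::
  "('e, 'f) cat \<Rightarrow> ('b, 'c) cat \<Rightarrow> ('e, 'f, 'b, 'c) proj \<Rightarrow> ('b, 'c) mnd \<Rightarrow>
    'e \<Rightarrow> 'e \<Rightarrow> 'e \<Rightarrow> 'e" where
  "phi E B p T X Y S = FObj (codensity E B p T (FObj p X) S) Y"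

definition Cls_cone ::
  "('e, 'f) cat \<Rightarrow> ('b, 'c) cat \<Rightarrow> ('e, 'f, 'b, 'c) proj \<Rightarrow> ('b, 'c) mnd \<Rightarrow>
    'v set \<Rightarrow> ('e \<Rightarrow> 'v \<Rightarrow> 'e) \<Rightarrow> bool" where
  "Cls_cone E B p T V r \<longleftrightarrow>
     (\<forall>X \<in> Obj E. r X \<in> V \<rightarrow> Cls E B p T X) \<and>
     (\<forall>X \<in> Obj E. \<forall>Y \<in> Obj E. split_le E X Y \<longrightarrow>
       (\<forall>v \<in> V. phi E B p T Y X (r Y v) = r X v))"

definition phi_inequality ::
  "('e, 'f) cat \<Rightarrow> ('b, 'c) cat \<Rightarrow> ('e, 'f, 'b, 'c) proj \<Rightarrow> ('b, 'c) mnd \<Rightarrow>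
    'v set \<Rightarrow> ('e \<Rightarrow> 'v \<Rightarrow> 'e) \<Rightarrow> bool" where
  "phi_inequality E B p T V r \<longleftrightarrow>
     (\<forall>X \<in> Obj E. \<forall>Y \<in> Obj E. \<forall>v \<in> V.
       r X v \<sqsubseteq>\<^bsub>fibre E B p (FObj T (FObj p X))\<^esub> phi E B p T Y X (r Y v))"

end

theory Submission
  imports Defs
begin

text \<open>Put \<open>S\<^sub>X = r\<^sub>X(v)\<close>. The \<open>\<phi>\<close>-inequality says that every \<open>f : X \<rightarrow> S\<^sub>Y\<close> has its Kleisli
  extension lifted to an arrow \<open>S\<^sub>X \<rightarrow> S\<^sub>Y\<close>, and \<open>S\<^sub>X = [S\<^sub>X]\<^sup>p\<^sup>XX\<close> lifts the unit to \<open>X \<rightarrow> S\<^sub>X\<close>,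
  because \<open>f\<^sup># \<circ> \<eta> = f\<close> and inverse image along \<open>\<eta>\<close> preserves the meet defining the codensity
  lifting. This is a Kleisli triple over \<open>T\<close>; since \<open>p\<close> is faithful, its laws hold and the lifting
  is determined by its objects.\<close>

text \<open>In a posetal fibration \<open>p\<close> is faithful, so this is the inclusion of
  \<open>E(X,Y)\<close> in \<open>B(pX,pY)\<close> as a relation: it replaces arrows of
  \<open>E\<close> by properties of arrows of \<open>B\<close>.\<close>

definition lifts :: "('e, 'f) cat \<Rightarrow> ('e, 'f, 'b, 'c) proj \<Rightarrow> 'c \<Rightarrow> 'e \<Rightarrow> 'e \<Rightarrow> bool" where
  "lifts E p u X Y \<longleftrightarrow> (\<exists>g \<in> Hom E X Y. FArr p g = u)"

lemma (in cat) hom_objD: "f \<in> Hom C X Y \<Longrightarrow> X \<in> Obj C \<and> Y \<in> Obj C"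
  using dom_obj cod_obj by (auto simp: Hom_def)

lemma hom_arr: "f \<in> Arr C \<longleftrightarrow> f \<in> Hom C (Dom C f) (Cod C f)"
  by (auto simp: Hom_def)

section \<open>Faithfulness of the projection and arrows into inverse images\<close>

context posetal_fibration
begin

lemma carrier_fibre [simp]: "carrier (fibre E B p I) = fibre_obj E p I"
  by (simp add: fibre_def)

lemma le_fibre_iff:
  "X \<in> fibre_obj E p I \<Longrightarrow> X \<sqsubseteq>\<^bsub>fibre E B p I\<^esub> Y \<longleftrightarrow> lifts E p (Ident B I) X Y"
  by (auto simp: fibre_def fibre_obj_def vertical_def lifts_def)

lemma fibre_antisym:
  assumes "X \<in> fibre_obj E p I" "Y \<in> fibre_obj E p I"
    and "lifts E p (Ident B I) X Y" "lifts E p (Ident B I) Y X"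
  shows "X = Y"
proof -
  have "I \<in> Obj B" using assms(1) fobj by (auto simp: fibre_obj_def)
  then interpret partial_order "fibre E B p I" by (rule fibre_order)
  show ?thesis using assms by (intro le_antisym) (simp_all add: le_fibre_iff)
qed

text \<open>Both arrows factor through one cartesian lift of their common image. The factors are
  vertical and parallel, hence equal.\<close>

lemma faithful:
  assumes f: "f \<in> Hom E X Y" and g: "g \<in> Hom E X Y" and eq: "FArr p f = FArr p g"
  shows "f = g"
proof -
  have XY: "X \<in> Obj E" "Y \<in> Obj E" using f dom.hom_objD by auto
  have pf: "FArr p f \<in> Hom B (FObj p X) (FObj p Y)" using f by (rule farr)
  obtain c where c: "c \<in> Arr E" "Cod E c = Y" "FArr p c = FArr p f" "cartesian E B p c"
    using cartesian_lift[OF XY(2) pf] by blast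
  have "FArr p c \<in> Hom B (FObj p (Dom E c)) (FObj p Y)"
    using c farr hom_arr by metis
  \<comment> \<open>An arrow of \<open>B\<close> determines its domain, so \<open>c\<close> and
    \<open>f\<close> start over the same object.\<close>
  then have D: "FObj p (Dom E c) = FObj p X" using pf c(3) by (auto simp: Hom_def)
  have id: "Ident B (FObj p X) \<in> Hom B (FObj p X) (FObj p (Dom E c))"
    using D cod.ident_hom fobj XY by auto
  \<comment> \<open>Taking the identity as the base arrow in the universal property makes the
    mediating arrows \<open>k\<close> and \<open>l\<close> vertical.\<close>
  have e: "FArr p f = FArr p c \<cdot>\<^bsub>B\<^esub> Ident B (FObj p X)"
    using cod.comp_ident[OF pf] c(3) by simp
  obtain k where k: "k \<in> Hom E X (Dom E c)" "FArr p k = Ident B (FObj p X)" "c \<cdot>\<^bsub>E\<^esub> k = f"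
    using c(2,4) XY(1) f id e unfolding cartesian_def by blast
  obtain l where l: "l \<in> Hom E X (Dom E c)" "FArr p l = Ident B (FObj p X)" "c \<cdot>\<^bsub>E\<^esub> l = g"
    using c(2,4) XY(1) g id e eq unfolding cartesian_def by metis
  have "k = l" using vertical_unique k l by (auto simp: vertical_def)
  then show ?thesis using k l by simp
qed

lemma lifts_comp:
  assumes "lifts E p u X Y" "lifts E p w Y Z"
  shows "lifts E p (w \<cdot>\<^bsub>B\<^esub> u) X Z"
  using assms farr_comp dom.comp_hom unfolding lifts_def by metis

text \<open>One direction composes with \<open>f\<close>; the other is the existence half of the
  universal property of a cartesian arrow.\<close>

lemma lifts_cartesian:
  assumes f: "f \<in> Hom E Z Y" "cartesian E B p f" and "X \<in> Obj E"
    and h: "h \<in> Hom B (FObj p X) (FObj p Z)"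
  shows "lifts E p h X Z \<longleftrightarrow> lifts E p (FArr p f \<cdot>\<^bsub>B\<^esub> h) X Y"
proof
  assume "lifts E p h X Z"
  then show "lifts E p (FArr p f \<cdot>\<^bsub>B\<^esub> h) X Y"
    using f lifts_comp[of h X Z "FArr p f" Y] by (auto simp: lifts_def)
next
  assume "lifts E p (FArr p f \<cdot>\<^bsub>B\<^esub> h) X Y"
  then obtain g where g: "g \<in> Hom E X Y" "FArr p g = FArr p f \<cdot>\<^bsub>B\<^esub> h"
    by (auto simp: lifts_def)
  have "Dom E f = Z" "Cod E f = Y" using f by (auto simp: Hom_def)
  then show "lifts E p h X Z"
    using f(2) assms(3) h g unfolding cartesian_def lifts_def by blast
qed

text \<open>This justifies the \<open>THE\<close> in \<open>inverse_image\<close>: domains of two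
  cartesian lifts of \<open>u\<close> are below each other in the fibre over \<open>I\<close>, so
  antisymmetry identifies them.\<close>

lemma inverse_image_cartesian:
  assumes Y: "Y \<in> Obj E" and u: "u \<in> Hom B I (FObj p Y)"
  shows "\<exists>f \<in> Hom E (inverse_image E B p u Y) Y. FArr p f = u \<and> cartesian E B p f"
proof -
  let ?P = "\<lambda>X. \<exists>f \<in> Hom E X Y. FArr p f = u \<and> cartesian E B p f"
  have fib: "X \<in> fibre_obj E p I" if "?P X" for X
  proof -
    obtain f where f: "f \<in> Hom E X Y" "FArr p f = u" using \<open>?P X\<close> by blast
    then show ?thesis
      using farr[OF f(1)] u dom.hom_objD[OF f(1)] by (auto simp: fibre_obj_def Hom_def)
  qed
  have le: "lifts E p (Ident B I) X Z" if X: "?P X" and Z: "?P Z" for X Z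
  proof -
    obtain f where f: "f \<in> Hom E Z Y" "FArr p f = u" "cartesian E B p f" using Z by blast
    have "X \<in> Obj E" and "Ident B I \<in> Hom B (FObj p X) (FObj p Z)"
      using fib[OF X] fib[OF Z] cod.ident_hom fobj by (auto simp: fibre_obj_def)
    moreover have "lifts E p (u \<cdot>\<^bsub>B\<^esub> Ident B I) X Y"
      using X cod.comp_ident[OF u] by (auto simp: lifts_def)
    ultimately show ?thesis using lifts_cartesian[OF f(1,3)] f(2) by simp
  qed
  obtain f where "f \<in> Arr E" "Cod E f = Y" "FArr p f = u" "cartesian E B p f"
    using cartesian_lift[OF Y u] by blast
  then have "?P (Dom E f)" by (auto simp: Hom_def)
  then show ?thesis unfolding inverse_image_def
    by (rule theI) (meson fibre_antisym fib le \<open>?P (Dom E f)\<close>)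
qed

lemma inverse_image_fibre:
  assumes "Y \<in> Obj E" and u: "u \<in> Hom B I (FObj p Y)"
  shows "inverse_image E B p u Y \<in> fibre_obj E p I"
proof -
  obtain f where f: "f \<in> Hom E (inverse_image E B p u Y) Y" "FArr p f = u"
    using inverse_image_cartesian[OF assms] by blast
  then show ?thesis
    using farr[OF f(1)] u dom.hom_objD[OF f(1)] by (auto simp: fibre_obj_def Hom_def)
qed

lemma lifts_inverse_image:
  assumes "Y \<in> Obj E" and u: "u \<in> Hom B I (FObj p Y)"
    and X: "X \<in> Obj E" and h: "h \<in> Hom B (FObj p X) I"
  shows "lifts E p h X (inverse_image E B p u Y) \<longleftrightarrow> lifts E p (u \<cdot>\<^bsub>B\<^esub> h) X Y"
proof -
  obtain f where f: "f \<in> Hom E (inverse_image E B p u Y) Y" "FArr p f = u" "cartesian E B p f"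
    using inverse_image_cartesian[OF assms(1,2)] by blast
  show ?thesis
    using lifts_cartesian[OF f(1,3) X] h f(2) inverse_image_fibre[OF assms(1,2)]
    by (simp add: fibre_obj_def)
qed

end

section \<open>Arrows into meets of a fibre\<close>

context posetal_fibration_with_limits
begin

lemma greatest_inf:
  assumes "I \<in> Obj B" "A \<subseteq> fibre_obj E p I"
  shows "greatest (fibre E B p I) (\<Sqinter>\<^bsub>fibre E B p I\<^esub> A) (Lower (fibre E B p I) A)"
  using someI_ex[OF meet_exists[OF assms]] by (simp add: inf_def)

text \<open>The universal property of a meet concerns vertical arrows only. Pulling back along
  \<open>h\<close> turns arrows above \<open>h\<close> into vertical ones, and
  \<open>meet_preserved\<close> says that the pulled back meet is still a meet.\<close>

lemma lifts_inf:
  assumes I: "I \<in> Obj B" and A: "A \<subseteq> fibre_obj E p I"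
    and X: "X \<in> Obj E" and h: "h \<in> Hom B (FObj p X) I"
  shows "lifts E p h X (\<Sqinter>\<^bsub>fibre E B p I\<^esub> A) \<longleftrightarrow> (\<forall>Y \<in> A. lifts E p h X Y)"
proof -
  let ?M = "\<Sqinter>\<^bsub>fibre E B p I\<^esub> A"
  let ?J = "FObj p X"
  note M = greatest_inf[OF I A]
  have MI: "?M \<in> fibre_obj E p I" using M by (auto simp: greatest_def Lower_def)
  have XJ: "X \<in> fibre_obj E p ?J" using X by (simp add: fibre_obj_def)
  \<comment> \<open>This is \<open>lifts_inverse_image\<close> for the base arrow \<open>h\<close>
    composed with the identity of \<open>?J\<close>.\<close>
  have iff: "X \<sqsubseteq>\<^bsub>fibre E B p ?J\<^esub> inverse_image E B p h Y \<longleftrightarrow> lifts E p h X Y"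
    if "Y \<in> fibre_obj E p I" for Y
  proof -
    have "Y \<in> Obj E" "h \<in> Hom B ?J (FObj p Y)" using that h by (auto simp: fibre_obj_def)
    then show ?thesis
      using lifts_inverse_image[OF _ _ X, of Y h ?J "Ident B ?J"] cod.ident_hom[OF fobj[OF X]]
        cod.comp_ident[OF h] le_fibre_iff[OF XJ] by simp
  qed
  show ?thesis
  proof
    assume hM: "lifts E p h X ?M"
    show "\<forall>Y \<in> A. lifts E p h X Y"
    proof
      fix Y assume "Y \<in> A"
      then have "?M \<sqsubseteq>\<^bsub>fibre E B p I\<^esub> Y" using M A by (auto simp: greatest_def Lower_def)
      then show "lifts E p h X Y"
        using lifts_comp[OF hM] cod.ident_comp[OF h] le_fibre_iff[OF MI] by metis
    qed
  next
    assume "\<forall>Y \<in> A. lifts E p h X Y"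
    then have "X \<in> Lower (fibre E B p ?J) (inverse_image E B p h ` A)"
      using iff A XJ by (auto simp: Lower_def)
    then have "X \<sqsubseteq>\<^bsub>fibre E B p ?J\<^esub> inverse_image E B p h ?M"
      using meet_preserved[OF h A M] by (auto simp: greatest_def)
    then show "lifts E p h X ?M" using iff[OF MI] by simp
  qed
qed

end

section \<open>Kleisli extension, construction of liftings and their equality\<close>

locale monad_over_fibration = posetal_fibration E B p + T: cat_monad B T
  for E :: "('e, 'f) cat" and B :: "('b, 'c) cat" and p :: "('e, 'f, 'b, 'c) proj"
    and T :: "('b, 'c) mnd"
begin

lemma kleisli_ext_hom:
  assumes "f \<in> Hom B I (FObj T R)" "R \<in> Obj B"
  shows "kleisli_ext B T R f \<in> Hom B (FObj T I) (FObj T R)"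
  unfolding kleisli_ext_def using assms T.farr T.mult_hom cod.comp_hom by blast

lemma kleisli_ext_unit:
  assumes f: "f \<in> Hom B I (FObj T R)" and R: "R \<in> Obj B"
  shows "kleisli_ext B T R f \<cdot>\<^bsub>B\<^esub> Unit T I = f"
proof -
  have I: "I \<in> Obj B" using f cod.hom_objD by blast
  have "kleisli_ext B T R f \<cdot>\<^bsub>B\<^esub> Unit T I = Mult T R \<cdot>\<^bsub>B\<^esub> (FArr T f \<cdot>\<^bsub>B\<^esub> Unit T I)"
    unfolding kleisli_ext_def
    by (rule cod.comp_assoc[OF T.unit_hom[OF I] T.farr[OF f] T.mult_hom[OF R]])
  also have "\<dots> = (Mult T R \<cdot>\<^bsub>B\<^esub> Unit T (FObj T R)) \<cdot>\<^bsub>B\<^esub> f"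
    using T.unit_natural[OF f]
      cod.comp_assoc[OF f T.unit_hom[OF T.fobj[OF R]] T.mult_hom[OF R]] by simp
  also have "\<dots> = f" using T.mult_unit[OF R] cod.ident_comp[OF f] by simp
  finally show ?thesis .
qed

text \<open>With \<open>kleisli_ext_ident\<close>, this recovers the functor and the multiplication
  from Kleisli extension, so that \<open>Lift_from_kleisli\<close> need not assume lifts of
  them.\<close>

lemma kleisli_ext_unit_comp:
  assumes f: "f \<in> Hom B I R"
  shows "kleisli_ext B T R (Unit T R \<cdot>\<^bsub>B\<^esub> f) = FArr T f"
proof -
  have R: "R \<in> Obj B" using f cod.hom_objD by blast
  note u = T.unit_hom[OF R]
  have "kleisli_ext B T R (Unit T R \<cdot>\<^bsub>B\<^esub> f) =
      Mult T R \<cdot>\<^bsub>B\<^esub> (FArr T (Unit T R) \<cdot>\<^bsub>B\<^esub> FArr T f)"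
    unfolding kleisli_ext_def using T.farr_comp[OF f u] by simp
  also have "\<dots> = (Mult T R \<cdot>\<^bsub>B\<^esub> FArr T (Unit T R)) \<cdot>\<^bsub>B\<^esub> FArr T f"
    using cod.comp_assoc[OF T.farr[OF f] T.farr[OF u] T.mult_hom[OF R]] by simp
  also have "\<dots> = FArr T f"
    using T.mult_map_unit[OF R] cod.ident_comp[OF T.farr[OF f]] by simp
  finally show ?thesis .
qed

lemma kleisli_ext_ident:
  assumes "R \<in> Obj B"
  shows "kleisli_ext B T R (Ident B (FObj T R)) = Mult T R"
  unfolding kleisli_ext_def
  using T.farr_ident[OF T.fobj[OF assms]] cod.comp_ident[OF T.mult_hom[OF assms]] by simp

text \<open>Each functor or monad law for \<open>L\<close> equates parallel arrows of
  \<open>E\<close> whose images under \<open>p\<close> are the two sides of the same law for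
  \<open>T\<close>; faithfulness reflects the equation.\<close>

lemma Lift_from_arrows:
  assumes L: "FObj L \<in> extensional (Obj E)" "FArr L \<in> extensional (Arr E)"
      "Unit L \<in> extensional (Obj E)" "Mult L \<in> extensional (Obj E)"
    and obj: "\<And>X. X \<in> Obj E \<Longrightarrow> FObj L X \<in> fibre_obj E p (FObj T (FObj p X))"
    and arr: "\<And>X Y f. f \<in> Hom E X Y \<Longrightarrow>
      FArr L f \<in> Hom E (FObj L X) (FObj L Y) \<and> FArr p (FArr L f) = FArr T (FArr p f)"
    and unit: "\<And>X. X \<in> Obj E \<Longrightarrow>
      Unit L X \<in> Hom E X (FObj L X) \<and> FArr p (Unit L X) = Unit T (FObj p X)"
    and mult: "\<And>X. X \<in> Obj E \<Longrightarrow>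
      Mult L X \<in> Hom E (FObj L (FObj L X)) (FObj L X) \<and> FArr p (Mult L X) = Mult T (FObj p X)"
  shows "L \<in> Lift E B p T"
proof -
  have O: "FObj L X \<in> Obj E" "FObj p (FObj L X) = FObj T (FObj p X)" if "X \<in> Obj E" for X
    using obj[OF that] by (auto simp: fibre_obj_def)
  note A = arr[THEN conjunct1] and pA = arr[THEN conjunct2]
  note U = unit[THEN conjunct1] and pU = unit[THEN conjunct2]
  note M = mult[THEN conjunct1] and pM = mult[THEN conjunct2]
  have "cat_monad E L"
  proof unfold_locales
    fix X assume X: "X \<in> Obj E"
    note OX = O[OF X] and pX = fobj[OF X] and UX = U[OF X] and MX = M[OF X]
    show "FObj L X \<in> Obj E" by (rule OX)
    show "FArr L (Ident E X) = Ident E (FObj L X)"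
      using X OX pX by (intro faithful[OF A])
        (auto simp: pA[OF dom.ident_hom] farr_ident T.farr_ident intro: dom.ident_hom)
    show "Unit L X \<in> Hom E X (FObj L X)" by (rule UX)
    show "Mult L X \<in> Hom E (FObj L (FObj L X)) (FObj L X)" by (rule MX)
    show "Mult L X \<cdot>\<^bsub>E\<^esub> Unit L (FObj L X) = Ident E (FObj L X)"
      by (rule faithful[OF dom.comp_hom[OF U[OF OX(1)] MX] dom.ident_hom[OF OX(1)]])
        (simp add: farr_comp[OF U[OF OX(1)] MX] pU pM X OX farr_ident T.mult_unit pX)
    show "Mult L X \<cdot>\<^bsub>E\<^esub> FArr L (Unit L X) = Ident E (FObj L X)"
      by (rule faithful[OF dom.comp_hom[OF A[OF UX] MX] dom.ident_hom[OF OX(1)]])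
        (simp add: farr_comp[OF A[OF UX] MX] pA[OF UX] pU pM X OX farr_ident
          T.mult_map_unit pX)
    show "Mult L X \<cdot>\<^bsub>E\<^esub> Mult L (FObj L X) = Mult L X \<cdot>\<^bsub>E\<^esub> FArr L (Mult L X)"
      by (rule faithful[OF dom.comp_hom[OF M[OF OX(1)] MX] dom.comp_hom[OF A[OF MX] MX]])
        (simp add: farr_comp[OF M[OF OX(1)] MX] farr_comp[OF A[OF MX] MX] pA[OF MX] pM X OX
          T.mult_mult pX)
  next
    fix f X Y assume f: "f \<in> Hom E X Y"
    have XY: "X \<in> Obj E" "Y \<in> Obj E" using dom.hom_objD[OF f] by auto
    note U' = U[OF XY(1)] U[OF XY(2)] and M' = M[OF XY(1)] M[OF XY(2)]
    show "FArr L f \<in> Hom E (FObj L X) (FObj L Y)" by (rule A[OF f])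
    show "FArr L f \<cdot>\<^bsub>E\<^esub> Unit L X = Unit L Y \<cdot>\<^bsub>E\<^esub> f"
      by (rule faithful[OF dom.comp_hom[OF U'(1) A[OF f]] dom.comp_hom[OF f U'(2)]])
        (simp add: farr_comp[OF U'(1) A[OF f]] farr_comp[OF f U'(2)] pA[OF f] pU XY
          T.unit_natural[OF farr[OF f]])
    show "FArr L f \<cdot>\<^bsub>E\<^esub> Mult L X = Mult L Y \<cdot>\<^bsub>E\<^esub> FArr L (FArr L f)"
      by (rule faithful[OF dom.comp_hom[OF M'(1) A[OF f]] dom.comp_hom[OF A[OF A[OF f]] M'(2)]])
        (simp add: farr_comp[OF M'(1) A[OF f]] farr_comp[OF A[OF A[OF f]] M'(2)] pA[OF f]
          pA[OF A[OF f]] pM XY T.mult_natural[OF farr[OF f]])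
  next
    fix f g X Y Z assume f: "f \<in> Hom E X Y" and g: "g \<in> Hom E Y Z"
    note gf = dom.comp_hom[OF f g]
    show "FArr L (g \<cdot>\<^bsub>E\<^esub> f) = FArr L g \<cdot>\<^bsub>E\<^esub> FArr L f"
      by (rule faithful[OF A[OF gf] dom.comp_hom[OF A[OF f] A[OF g]]])
        (simp add: farr_comp[OF A[OF f] A[OF g]] pA[OF gf] pA[OF f] pA[OF g]
          farr_comp[OF f g] T.farr_comp[OF farr[OF f] farr[OF g]])
  qed
  moreover have "FArr p (FArr L f) = FArr T (FArr p f)" if "f \<in> Arr E" for f
    using pA that hom_arr by metis
  ultimately show ?thesis using L O pU pM by (simp add: Lift_def)
qed

text \<open>The Kleisli triple form of a lifting: the laws come from \<open>T\<close>, so only the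
  existence of lifts has to be supplied.\<close>

lemma Lift_from_kleisli:
  assumes obj: "\<And>X. X \<in> Obj E \<Longrightarrow> D X \<in> fibre_obj E p (FObj T (FObj p X))"
    and unit: "\<And>X. X \<in> Obj E \<Longrightarrow> lifts E p (Unit T (FObj p X)) X (D X)"
    and ext: "\<And>X Y f. Y \<in> Obj E \<Longrightarrow> f \<in> Hom E X (D Y) \<Longrightarrow>
      lifts E p (kleisli_ext B T (FObj p Y) (FArr p f)) (D X) (D Y)"
  shows "\<exists>L \<in> Lift E B p T. \<forall>X \<in> Obj E. FObj L X = D X"
proof -
  have map: "lifts E p (FArr T (FArr p f)) (D X) (D Y)" if f: "f \<in> Hom E X Y" for f X Y
  proof -
    have Y: "Y \<in> Obj E" using f dom.hom_objD by blast
    \<comment> \<open>Composing \<open>f\<close> with the lifted unit gives an arrow into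
      \<open>D Y\<close>, whose extension lies above \<open>T\<close> applied to the image of
      \<open>f\<close>.\<close>
    obtain u where u: "u \<in> Hom E Y (D Y)" "FArr p u = Unit T (FObj p Y)"
      using unit[OF Y] by (auto simp: lifts_def)
    show ?thesis
      using ext[OF Y dom.comp_hom[OF f u(1)]] farr_comp[OF f u(1)] u(2)
        kleisli_ext_unit_comp[OF farr[OF f]] by simp
  qed
  have mult: "lifts E p (Mult T (FObj p X)) (D (D X)) (D X)" if X: "X \<in> Obj E" for X
  proof -
    have DX: "D X \<in> Obj E" "FObj p (D X) = FObj T (FObj p X)"
      using obj[OF X] by (auto simp: fibre_obj_def)
    \<comment> \<open>The multiplication is the extension of the identity of \<open>D X\<close>,
      read as an arrow from \<open>D X\<close> into \<open>D X\<close> with parameter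
      \<open>X\<close>.\<close>
    show ?thesis
      using ext[OF X dom.ident_hom[OF DX(1)]] farr_ident[OF DX(1)] DX(2)
        kleisli_ext_ident[OF fobj[OF X]] by simp
  qed
  \<comment> \<open>By faithfulness the choice is forced whenever a lift exists.\<close>
  define arrow where "arrow u X Y = (SOME g. g \<in> Hom E X Y \<and> FArr p g = u)" for u X Y
  have arrow: "arrow u X Y \<in> Hom E X Y \<and> FArr p (arrow u X Y) = u" if "lifts E p u X Y" for u X Y
    unfolding arrow_def by (rule someI_ex) (use that in \<open>auto simp: lifts_def\<close>)
  define L where "L = \<lparr> FObj = restrict D (Obj E),
      FArr = (\<lambda>f \<in> Arr E. arrow (FArr T (FArr p f)) (D (Dom E f)) (D (Cod E f))),
      Unit = (\<lambda>X \<in> Obj E. arrow (Unit T (FObj p X)) X (D X)),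
      Mult = (\<lambda>X \<in> Obj E. arrow (Mult T (FObj p X)) (D (D X)) (D X)) \<rparr>"
  have "L \<in> Lift E B p T"
  proof (rule Lift_from_arrows)
    fix f X Y assume f: "f \<in> Hom E X Y"
    then have "f \<in> Arr E" "Dom E f = X" "Cod E f = Y" "X \<in> Obj E" "Y \<in> Obj E"
      using dom.hom_objD by (auto simp: Hom_def)
    then show "FArr L f \<in> Hom E (FObj L X) (FObj L Y) \<and> FArr p (FArr L f) = FArr T (FArr p f)"
      using arrow[OF map[OF f]] by (simp add: L_def)
  next
    fix X assume X: "X \<in> Obj E"
    then have "D X \<in> Obj E" using obj by (auto simp: fibre_obj_def)
    then show "Mult L X \<in> Hom E (FObj L (FObj L X)) (FObj L X) \<and>
        FArr p (Mult L X) = Mult T (FObj p X)"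
      using X arrow[OF mult[OF X]] by (simp add: L_def)
  qed (use obj arrow[OF unit] in \<open>simp_all add: L_def\<close>)
  moreover have "\<forall>X \<in> Obj E. FObj L X = D X" by (simp add: L_def)
  ultimately show ?thesis by blast
qed

text \<open>Once the object parts agree, corresponding arrows are parallel with equal images under
  \<open>p\<close>, so faithfulness identifies them. Extensionality settles the values outside
  \<open>E\<close>.\<close>

lemma Lift_eqI:
  assumes L: "L \<in> Lift E B p T" and M: "M \<in> Lift E B p T"
    and eq: "\<And>X. X \<in> Obj E \<Longrightarrow> FObj L X = FObj M X"
  shows "L = M"
proof -
  interpret L: cat_monad E L using L by (simp add: Lift_def)
  interpret M: cat_monad E M using M by (simp add: Lift_def)
  have 1: "FObj L = FObj M"
    using L M eq by (intro extensionalityI[of _ "Obj E"]) (simp_all add: Lift_def)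
  have 2: "FArr L = FArr M"
  proof (rule extensionalityI)
    fix f assume f: "f \<in> Arr E"
    show "FArr L f = FArr M f"
      using L.farr M.farr f[unfolded hom_arr] 1 L M f
      by (intro faithful[of _ "FObj M (Dom E f)" "FObj M (Cod E f)"])
        (force simp: Lift_def)+
  qed (use L M in \<open>simp_all add: Lift_def\<close>)
  have 3: "Unit L = Unit M"
  proof (rule extensionalityI)
    fix X assume X: "X \<in> Obj E"
    show "Unit L X = Unit M X"
      using L.unit_hom[OF X] M.unit_hom[OF X] 1 L M X
      by (intro faithful[of _ X "FObj M X"]) (simp_all add: Lift_def)
  qed (use L M in \<open>simp_all add: Lift_def\<close>)
  have 4: "Mult L = Mult M"
  proof (rule extensionalityI)
    fix X assume X: "X \<in> Obj E"
    show "Mult L X = Mult M X"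
      using L.mult_hom[OF X] M.mult_hom[OF X] 1 L M X
      by (intro faithful[of _ "FObj M (FObj M X)" "FObj M X"]) (simp_all add: Lift_def)
  qed (use L M in \<open>simp_all add: Lift_def\<close>)
  show ?thesis using 1 2 3 4 by simp
qed

end

section \<open>Arrows into codensity liftings\<close>

locale monad_over_fibration_with_limits =
  posetal_fibration_with_limits E B p + monad_over_fibration E B p T
  for E :: "('e, 'f) cat" and B :: "('b, 'c) cat" and p :: "('e, 'f, 'b, 'c) proj"
    and T :: "('b, 'c) mnd"
begin

text \<open>The codensity object is a meet of inverse images of \<open>S\<close>, so
  \<open>lifts_inf\<close> splits the claim over the test arrows \<open>f\<close> and
  \<open>lifts_inverse_image\<close> transposes each part.\<close>

lemma lifts_codensity:
  assumes R: "R \<in> Obj B" and S: "S \<in> fibre_obj E p (FObj T R)" and Y: "Y \<in> Obj E"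
    and X: "X \<in> Obj E" and h: "h \<in> Hom B (FObj p X) (FObj T (FObj p Y))"
  shows "lifts E p h X (FObj (codensity E B p T R S) Y) \<longleftrightarrow>
    (\<forall>f \<in> Hom E Y S. lifts E p (kleisli_ext B T R (FArr p f) \<cdot>\<^bsub>B\<^esub> h) X S)"
proof -
  have S': "S \<in> Obj E" "FObj p S = FObj T R" using S by (auto simp: fibre_obj_def)
  have k: "kleisli_ext B T R (FArr p f) \<in> Hom B (FObj T (FObj p Y)) (FObj p S)"
    if "f \<in> Hom E Y S" for f
    using farr[OF that] S' R kleisli_ext_hom by simp
  let ?A = "(\<lambda>f. inverse_image E B p (kleisli_ext B T R (FArr p f)) S) ` Hom E Y S"
  have "?A \<subseteq> fibre_obj E p (FObj T (FObj p Y))"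
    using inverse_image_fibre[OF S'(1) k] by blast
  from lifts_inf[OF T.fobj[OF fobj[OF Y]] this X h] show ?thesis
    using Y lifts_inverse_image[OF S'(1) k X h] by (simp add: codensity_def codensity_obj_def)
qed

lemma unit_lifts_Cls:
  assumes X: "X \<in> Obj E" and S: "S \<in> Cls E B p T X"
  shows "lifts E p (Unit T (FObj p X)) X S"
proof -
  have S': "S \<in> fibre_obj E p (FObj T (FObj p X))"
    "S = FObj (codensity E B p T (FObj p X) S) X"
    using S by (auto simp: Cls_def)
  note pX = fobj[OF X]
  have "lifts E p (kleisli_ext B T (FObj p X) (FArr p f) \<cdot>\<^bsub>B\<^esub> Unit T (FObj p X)) X S"
    if f: "f \<in> Hom E X S" for f
  proof -
    have "FArr p f \<in> Hom B (FObj p X) (FObj T (FObj p X))"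
      using farr[OF f] S'(1) by (simp add: fibre_obj_def)
    \<comment> \<open>The composite collapses to \<open>FArr p f\<close>, which the test arrow
      \<open>f\<close> itself lifts.\<close>
    then show ?thesis using f kleisli_ext_unit[OF _ pX] by (auto simp: lifts_def)
  qed
  then show ?thesis
    using lifts_codensity[OF pX S'(1) X X T.unit_hom[OF pX]] S'(2) by simp
qed

text \<open>The inequality is a lift of an identity into a codensity object;
  \<open>lifts_codensity\<close> unfolds it into a statement about all test arrows, of which
  \<open>f\<close> is one.\<close>

lemma kleisli_ext_lifts:
  assumes X: "X \<in> Obj E" and Y: "Y \<in> Obj E"
    and S: "S \<in> fibre_obj E p (FObj T (FObj p X))"
    and S': "S' \<in> fibre_obj E p (FObj T (FObj p Y))"
    and le: "S \<sqsubseteq>\<^bsub>fibre E B p (FObj T (FObj p X))\<^esub> phi E B p T Y X S'"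
    and f: "f \<in> Hom E X S'"
  shows "lifts E p (kleisli_ext B T (FObj p Y) (FArr p f)) S S'"
proof -
  let ?I = "FObj T (FObj p X)"
  have SX: "S \<in> Obj E" "FObj p S = ?I" using S by (auto simp: fibre_obj_def)
  have id: "Ident B ?I \<in> Hom B (FObj p S) ?I"
    using cod.ident_hom[OF T.fobj[OF fobj[OF X]]] SX by simp
  have "lifts E p (Ident B ?I) S (FObj (codensity E B p T (FObj p Y) S') X)"
    using le le_fibre_iff[OF S] by (simp add: phi_def)
  then have "lifts E p (kleisli_ext B T (FObj p Y) (FArr p f) \<cdot>\<^bsub>B\<^esub> Ident B ?I) S S'"
    using lifts_codensity[OF fobj[OF Y] S' X SX(1) id] f by blast
  moreover have "FArr p f \<in> Hom B (FObj p X) (FObj T (FObj p Y))"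
    using farr[OF f] S' by (simp add: fibre_obj_def)
  ultimately show ?thesis
    using cod.comp_ident[OF kleisli_ext_hom[OF _ fobj[OF Y]]] by simp
qed

end

section \<open>Existence and uniqueness of the map into liftings\<close>

theorem theorem8p11:
  fixes E :: "('e, 'f) cat" and B :: "('b, 'c) cat" and p :: "('e, 'f, 'b, 'c) proj"
    and T :: "('b, 'c) mnd" and V :: "'v set" and r :: "'e \<Rightarrow> 'v \<Rightarrow> 'e"
  assumes "posetal_fibration_with_limits E B p"
    and "cat_monad B T"
    and "Cls_cone E B p T V r"
    and "phi_inequality E B p T V r"
  shows "\<exists>!m. m \<in> V \<rightarrow>\<^sub>E Lift E B p T \<and> (\<forall>X \<in> Obj E. \<forall>v \<in> V. r X v = q_map X (m v))"
proof -
  interpret posetal_fibration_with_limits E B p by fact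
  interpret T: cat_monad B T by fact
  interpret monad_over_fibration_with_limits E B p T by unfold_locales
  have r: "r X v \<in> Cls E B p T X" if "X \<in> Obj E" "v \<in> V" for X v
    using assms(3) that by (auto simp: Cls_cone_def)
  have fib: "r X v \<in> fibre_obj E p (FObj T (FObj p X))" if "X \<in> Obj E" "v \<in> V" for X v
    using r[OF that] by (simp add: Cls_def)
  have "\<exists>L \<in> Lift E B p T. \<forall>X \<in> Obj E. FObj L X = r X v" if v: "v \<in> V" for v
  proof (rule Lift_from_kleisli)
    fix X Y f assume Y: "Y \<in> Obj E" and f: "f \<in> Hom E X (r Y v)"
    then have X: "X \<in> Obj E" using dom.hom_objD by blast
    \<comment> \<open>The codomain of \<open>f\<close> lies over \<open>Y\<close>, so
      \<open>Y\<close> is the codensity parameter, and \<open>X\<close>, the domain of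
      \<open>f\<close>, is where the lifting is evaluated.\<close>
    have "r X v \<sqsubseteq>\<^bsub>fibre E B p (FObj T (FObj p X))\<^esub> phi E B p T Y X (r Y v)"
      using assms(4) X Y v by (simp add: phi_inequality_def)
    then show "lifts E p (kleisli_ext B T (FObj p Y) (FArr p f)) (r X v) (r Y v)"
      using kleisli_ext_lifts[OF X Y fib[OF X v] fib[OF Y v] _ f] by simp
  qed (use v fib unit_lifts_Cls[OF _ r] in blast)+
  then obtain m where m: "\<And>v. v \<in> V \<Longrightarrow> m v \<in> Lift E B p T"
      "\<And>v X. v \<in> V \<Longrightarrow> X \<in> Obj E \<Longrightarrow> FObj (m v) X = r X v"
    by metis
  show ?thesis
  proof (rule ex1I)
    \<comment> \<open>The chosen \<open>m\<close> is arbitrary off \<open>V\<close>; restriction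
      makes it the extensional function required.\<close>
    show "restrict m V \<in> V \<rightarrow>\<^sub>E Lift E B p T \<and>
        (\<forall>X \<in> Obj E. \<forall>v \<in> V. r X v = q_map X (restrict m V v))"
      using m by (auto simp: q_map_def)
  next
    fix n assume n: "n \<in> V \<rightarrow>\<^sub>E Lift E B p T \<and> (\<forall>X \<in> Obj E. \<forall>v \<in> V. r X v = q_map X (n v))"
    show "n = restrict m V"
    proof (rule extensionalityI)
      show "n \<in> extensional V" using n by (simp add: PiE_def)
      fix v assume "v \<in> V"
      then show "n v = restrict m V v"
        \<comment> \<open>Both liftings have object part \<open>r X v\<close> at each
          \<open>X\<close>, and a lifting is determined by its object part.\<close>
        using n m by (auto simp: q_map_def intro!: Lift_eqI)
    qed simp
  qed
qed

end
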